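(* Let $(F,\le)$ be an ordered field and $n$ a positive integer. Every archimedean class of $M_{\ast,n}(F)$ (that is, every equivalence class of $\sim_n$ on $M_{\ast,n}(F)$) contains a square ($n\times n$) matrix which is a row echelon form.
   Context: $M_{\ast,n}(F)=\bigcup_{m\ge 1}M_{m,n}(F)$ is the set of all matrices over $F$ with $n$ columns and arbitrarily many rows. For symmetric $S,T\in M_n(F)$ write $S\le_n T$ iff $T-S$ is positive semidefinite, i.e. $v^T(T-S)v\ge 0$ for all $v\in F^n$. For $A,B\in M_{\ast,n}(F)$ write $A\succeq_n B$ iff there is $r\in\mathbb N$ such that $A^TA\le_n rB^TB$, and $A\sim_n B$ iff $A\succeq_n B$ and $B\succeq_n A$. A matrix is a row echelon form if all its zero rows are at the bottom and, for each $i$, the first nonzero element of the $(i+1)$-th nonzero row lies strictly to the right of (in a column of larger index than) the first nonzero element of the $i$-th nonzero row (pivots are not required to equal $1$, and entries above pivots are not required to vanish). *)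

theory Defs
  imports "Jordan_Normal_Form.Matrix"
begin

definition mats :: "nat \<Rightarrow> 'a :: linordered_field mat set" where
  "mats n = (\<Union>m \<in> {1..}. carrier_mat m n)"

definition pos_semidef :: "nat \<Rightarrow> 'a :: linordered_field mat \<Rightarrow> bool" where
  "pos_semidef n S \<longleftrightarrow> (\<forall>v \<in> carrier_vec n. v \<bullet> (S *\<^sub>v v) \<ge> 0)"

text \<open>Intended for symmetric matrices of size n by n only; in \<open>arch_ge\<close> below it is
  applied exclusively to (multiples of) Gram matrices of matrices with n columns.\<close>

definition psd_le :: "nat \<Rightarrow> 'a :: linordered_field mat \<Rightarrow> 'a mat \<Rightarrow> bool" where
  "psd_le n S T \<longleftrightarrow> pos_semidef n (T - S)"

definition arch_ge :: "nat \<Rightarrow> 'a :: linordered_field mat \<Rightarrow> 'a mat \<Rightarrow> bool" where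
  "arch_ge n A B \<longleftrightarrow>
     (\<exists>r :: nat. psd_le n (transpose_mat A * A) (of_nat r \<cdot>\<^sub>m (transpose_mat B * B)))"

definition arch_rel :: "nat \<Rightarrow> ('a :: linordered_field mat \<times> 'a mat) set" where
  "arch_rel n = {(A, B). A \<in> mats n \<and> B \<in> mats n \<and> arch_ge n A B \<and> arch_ge n B A}"

lemma arch_ge_iff:
  assumes "A \<in> mats n" and "B \<in> mats n"
  shows "arch_ge n A B \<longleftrightarrow> (\<exists>r :: nat. \<forall>v \<in> carrier_vec n.
           (A *\<^sub>v v) \<bullet> (A *\<^sub>v v) \<le> of_nat r * ((B *\<^sub>v v) \<bullet> (B *\<^sub>v v)))"
proof -
  obtain m l where A: "A \<in> carrier_mat m n" and B: "B \<in> carrier_mat l n"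
    using assms by (auto simp: mats_def)
  have gram: "v \<bullet> ((transpose_mat M * M) *\<^sub>v v) = (M *\<^sub>v v) \<bullet> (M *\<^sub>v v)"
    if M: "M \<in> carrier_mat k n" and v: "v \<in> carrier_vec n"
    for M :: "'a mat" and k v
  proof -
    have Mv: "M *\<^sub>v v \<in> carrier_vec k" using M v by simp
    have "v \<bullet> ((transpose_mat M * M) *\<^sub>v v) = v \<bullet> (transpose_mat M *\<^sub>v (M *\<^sub>v v))"
      using M v by (simp add: assoc_mult_mat_vec[of _ n k _ n])
    also have "\<dots> = (M *\<^sub>v v) \<bullet> (M *\<^sub>v v)"
      using transpose_vec_mult_scalar[OF M v Mv] M v Mv
      by (metis comm_scalar_prod mult_mat_vec_carrier transpose_carrier_mat)
    finally show ?thesis .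
  qed
  have "v \<bullet> ((c \<cdot>\<^sub>m (transpose_mat B * B) - transpose_mat A * A) *\<^sub>v v)
      = c * ((B *\<^sub>v v) \<bullet> (B *\<^sub>v v)) - (A *\<^sub>v v) \<bullet> (A *\<^sub>v v)"
    if v: "v \<in> carrier_vec n" for v c
  proof -
    have GA: "transpose_mat A * A \<in> carrier_mat n n" and GB: "transpose_mat B * B \<in> carrier_mat n n"
      using A B by auto
    have "(c \<cdot>\<^sub>m (transpose_mat B * B) - transpose_mat A * A) *\<^sub>v v
      = c \<cdot>\<^sub>v ((transpose_mat B * B) *\<^sub>v v) - (transpose_mat A * A) *\<^sub>v v"
      using GA GB v
      by (subst minus_mult_distrib_mat_vec[of _ n n])
         (auto intro!: eq_vecI arg_cong2[where f = minus]
               simp: scalar_prod_def sum_distrib_left mult.assoc simp del: index_mult_mat)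
    then show ?thesis
      using gram[OF A v] gram[OF B v] GA GB v
      by (simp add: scalar_prod_minus_distrib[of _ n])
  qed
  then show ?thesis by (simp add: arch_ge_def psd_le_def pos_semidef_def)
qed

lemma equiv_arch_rel: "equiv (mats n) (arch_rel n :: ('a :: linordered_field mat \<times> 'a mat) set)"
proof (rule equivI)
  show "arch_rel n \<subseteq> mats n \<times> (mats n :: 'a mat set)"
    by (auto simp: arch_rel_def)
  have "arch_ge n A A" if "A \<in> mats n" for A :: "'a mat"
    unfolding arch_ge_iff[OF that that] by (rule exI[of _ 1]) simp
  then show "refl_on (mats n) (arch_rel n :: ('a mat \<times> 'a mat) set)"
    by (auto simp: refl_on_def arch_rel_def)
  show "sym (arch_rel n :: ('a mat \<times> 'a mat) set)"
    by (auto simp: sym_def arch_rel_def)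
  have tr: "arch_ge n A C" if M: "A \<in> mats n" "B \<in> mats n" "C \<in> mats n"
    and AB: "arch_ge n A B" and BC: "arch_ge n B C" for A B C :: "'a mat"
  proof -
    from AB obtain r :: nat where r: "\<forall>v \<in> carrier_vec n.
      (A *\<^sub>v v) \<bullet> (A *\<^sub>v v) \<le> of_nat r * ((B *\<^sub>v v) \<bullet> (B *\<^sub>v v))"
      unfolding arch_ge_iff[OF M(1,2)] by blast
    from BC obtain s :: nat where s: "\<forall>v \<in> carrier_vec n.
      (B *\<^sub>v v) \<bullet> (B *\<^sub>v v) \<le> of_nat s * ((C *\<^sub>v v) \<bullet> (C *\<^sub>v v))"
      unfolding arch_ge_iff[OF M(2,3)] by blast
    have "(A *\<^sub>v v) \<bullet> (A *\<^sub>v v) \<le> of_nat (r * s) * ((C *\<^sub>v v) \<bullet> (C *\<^sub>v v))"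
      if v: "v \<in> carrier_vec n" for v
    proof -
      have "of_nat r * ((B *\<^sub>v v) \<bullet> (B *\<^sub>v v))
          \<le> of_nat r * (of_nat s * ((C *\<^sub>v v) \<bullet> (C *\<^sub>v v)))"
        using s v by (intro mult_left_mono) auto
      with r v show ?thesis by (force simp: mult.assoc)
    qed
    then show ?thesis unfolding arch_ge_iff[OF M(1,3)] by blast
  qed
  show "trans (arch_rel n :: ('a mat \<times> 'a mat) set)"
    unfolding trans_def arch_rel_def using tr by blast
qed

definition arch_classes :: "nat \<Rightarrow> 'a :: linordered_field mat set set" where
  "arch_classes n = mats n // arch_rel n"

definition zero_row :: "'a :: zero mat \<Rightarrow> nat \<Rightarrow> bool" where
  "zero_row A i \<longleftrightarrow> (\<forall>j < dim_col A. A $$ (i, j) = 0)"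

definition lead_col :: "'a :: zero mat \<Rightarrow> nat \<Rightarrow> nat" where
  "lead_col A i = (LEAST j. j < dim_col A \<and> A $$ (i, j) \<noteq> 0)"

text \<open>Once the zero rows are known to be at the bottom, the nonzero rows are
  consecutive, so the successor of a nonzero row among the nonzero rows is simply the next row.
  Unlike in the library predicate \<open>row_echelon_form\<close>, pivots need not be 1 and entries
  above pivots need not vanish.\<close>

definition echelon :: "'a :: zero mat \<Rightarrow> bool" where
  "echelon A \<longleftrightarrow>
     (\<forall>i k. i < k \<and> k < dim_row A \<and> zero_row A i \<longrightarrow> zero_row A k) \<and>
     (\<forall>i. Suc i < dim_row A \<and> \<not> zero_row A i \<and> \<not> zero_row A (Suc i) \<longrightarrow>
        lead_col A i < lead_col A (Suc i))"

end

theory Submission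
  imports Defs
begin

text \<open>The proof is Gaussian elimination with partial pivoting. Over an ordered field that may
  contain infinitely large elements, a row operation \<open>x \<mapsto> x - c p\<close> can change the
  archimedean class, because \<open>c\<close> need not be bounded by a natural number. If, however, the
  pivot row \<open>p\<close> is chosen with an entry of maximal absolute value in the column that is
  being cleared, then every multiplier satisfies \<open>\<bar>c\<bar> \<le> 1\<close>, so that both the operation
  and its inverse change the quadratic form \<open>v \<mapsto> \<parallel>A v\<parallel>\<^sup>2\<close> by at most a natural factor.

  The bookkeeping is done row by row. A vector \<open>x\<close> is dominated by the rows \<open>ys\<close> if
  \<open>(x \<bullet> v)\<^sup>2\<close> is at most a fixed natural multiple of \<open>\<Sum> (y \<bullet> v)\<^sup>2\<close>, for all
  \<open>v\<close>. Since a matrix has finitely many rows, two matrices are equivalent as soon as the rows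
  of each are dominated by the rows of the other (\<open>arch_ge_if_rows_dominated\<close>). Domination is
  transitive and stable under adding multiples with coefficients in \<open>[-1, 1]\<close>
  (\<open>dominated_add_multiple\<close>), which makes elimination preserve mutual domination
  (\<open>echelon_rows_exist\<close>). The pivots of the nonzero rows obtained lie in different columns, so
  there are at most \<open>n\<close> such rows; zero rows fill up to a square matrix.\<close>

section \<open>Domination of a row by a list of rows\<close>

definition sum_sq :: "'a :: linordered_field vec list \<Rightarrow> 'a vec \<Rightarrow> 'a" where
  "sum_sq ys v = (\<Sum>y \<leftarrow> ys. (y \<bullet> v)\<^sup>2)"

definition dominated :: "nat \<Rightarrow> 'a :: linordered_field vec list \<Rightarrow> 'a vec \<Rightarrow> bool" where
  "dominated n ys x \<longleftrightarrow> (\<exists>r :: nat. \<forall>v \<in> carrier_vec n. (x \<bullet> v)\<^sup>2 \<le> of_nat r * sum_sq ys v)"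

lemma dominated_member:
  assumes "x \<in> set ys"
  shows "dominated n ys x"
proof -
  have "(x \<bullet> v)\<^sup>2 \<le> sum_sq ys v" for v
    unfolding sum_sq_def using assms by (intro member_le_sum_list) auto
  then show ?thesis unfolding dominated_def by (intro exI[of _ 1]) simp
qed

lemma dominated_zero: "dominated n ys (0\<^sub>v n)"
  unfolding dominated_def by (intro exI[of _ 0]) simp

text \<open>Finitely many bounds of the form natural multiple of \<open>sum_sq ys\<close> add up to one.\<close>

lemma sum_sq_le_if_dominated:
  assumes "\<forall>x \<in> set xs. dominated n ys x"
  shows "\<exists>r :: nat. \<forall>v \<in> carrier_vec n. sum_sq xs v \<le> of_nat r * sum_sq ys v"
  using assms
proof (induction xs)
  case Nil
  then show ?case by (intro exI[of _ 0]) (simp add: sum_sq_def)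
next
  case (Cons x xs)
  then obtain r s :: nat
    where r: "\<forall>v \<in> carrier_vec n. sum_sq xs v \<le> of_nat r * sum_sq ys v"
      and s: "\<forall>v \<in> carrier_vec n. (x \<bullet> v)\<^sup>2 \<le> of_nat s * sum_sq ys v"
    unfolding dominated_def by auto
  have "sum_sq (x # xs) v \<le> of_nat (s + r) * sum_sq ys v" if "v \<in> carrier_vec n" for v
  proof -
    have "sum_sq (x # xs) v = (x \<bullet> v)\<^sup>2 + sum_sq xs v"
      by (simp add: sum_sq_def)
    also have "\<dots> \<le> of_nat s * sum_sq ys v + of_nat r * sum_sq ys v"
      using r s that by (intro add_mono) auto
    finally show ?thesis by (simp add: distrib_right)
  qed
  then show ?case by blast
qed

lemma dominated_trans:
  assumes "dominated n ys x" and "\<forall>y \<in> set ys. dominated n zs y"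
  shows "dominated n zs x"
proof -
  obtain r :: nat where r: "\<forall>v \<in> carrier_vec n. (x \<bullet> v)\<^sup>2 \<le> of_nat r * sum_sq ys v"
    using assms(1) unfolding dominated_def by blast
  obtain s :: nat where s: "\<forall>v \<in> carrier_vec n. sum_sq ys v \<le> of_nat s * sum_sq zs v"
    using sum_sq_le_if_dominated[OF assms(2)] by blast
  have "(x \<bullet> v)\<^sup>2 \<le> of_nat (r * s) * sum_sq zs v" if v: "v \<in> carrier_vec n" for v
  proof -
    have "(x \<bullet> v)\<^sup>2 \<le> of_nat r * sum_sq ys v"
      using r v by blast
    also have "\<dots> \<le> of_nat r * (of_nat s * sum_sq zs v)"
      using s v by (intro mult_left_mono) auto
    finally show ?thesis by (simp add: mult.assoc)
  qed
  then show ?thesis unfolding dominated_def by blast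
qed

lemma dominated_mono:
  assumes "dominated n ys x" and "set ys \<subseteq> set zs"
  shows "dominated n zs x"
  using assms by (blast intro: dominated_trans dominated_member)

text \<open>This is where the size of the multiplier matters: by \<open>(a + b)\<^sup>2 \<le> 2 a\<^sup>2 + 2 b\<^sup>2\<close>,
  a multiplier \<open>c\<close> contributes the factor \<open>2 c\<^sup>2\<close>, which has to be bounded by a natural
  number.\<close>

lemma dominated_add_multiple:
  assumes "dominated n ys x" and "dominated n ys p"
    and x: "x \<in> carrier_vec n" and p: "p \<in> carrier_vec n"
    and c: "\<bar>c\<bar> \<le> 1"
  shows "dominated n ys (x + c \<cdot>\<^sub>v p)"
proof -
  obtain r s :: nat
    where r: "\<forall>v \<in> carrier_vec n. (x \<bullet> v)\<^sup>2 \<le> of_nat r * sum_sq ys v"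
      and s: "\<forall>v \<in> carrier_vec n. (p \<bullet> v)\<^sup>2 \<le> of_nat s * sum_sq ys v"
    using assms(1,2) unfolding dominated_def by blast
  have "((x + c \<cdot>\<^sub>v p) \<bullet> v)\<^sup>2 \<le> of_nat (2 * r + 2 * s) * sum_sq ys v"
    if v: "v \<in> carrier_vec n" for v
  proof -
    have "c\<^sup>2 \<le> 1"
      using c by (simp add: abs_square_le_1)
    then have cp: "c\<^sup>2 * (p \<bullet> v)\<^sup>2 \<le> (p \<bullet> v)\<^sup>2"
      by (simp add: mult_left_le_one_le)
    have "(x + c \<cdot>\<^sub>v p) \<bullet> v = x \<bullet> v + c * (p \<bullet> v)"
      using x p v by (simp add: add_scalar_prod_distrib[of _ n])
    then have "((x + c \<cdot>\<^sub>v p) \<bullet> v)\<^sup>2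
        = 2 * (x \<bullet> v)\<^sup>2 + 2 * (c\<^sup>2 * (p \<bullet> v)\<^sup>2) - (x \<bullet> v - c * (p \<bullet> v))\<^sup>2"
      by (simp add: power2_eq_square algebra_simps)
    also have "\<dots> \<le> 2 * (x \<bullet> v)\<^sup>2 + 2 * (c\<^sup>2 * (p \<bullet> v)\<^sup>2)"
      by simp
    also have "\<dots> \<le> 2 * (of_nat r * sum_sq ys v) + 2 * (of_nat s * sum_sq ys v)"
      using r s v cp by (intro add_mono mult_left_mono) force+
    finally show ?thesis by (simp add: algebra_simps)
  qed
  then show ?thesis unfolding dominated_def by blast
qed

lemma norm_sq_eq_sum_sq_rows:
  assumes "A \<in> carrier_mat m n"
  shows "(A *\<^sub>v v) \<bullet> (A *\<^sub>v v) = sum_sq (rows A) v"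
  using assms
  by (simp add: sum_sq_def rows_def scalar_prod_def[of "A *\<^sub>v v"] power2_eq_square
      interv_sum_list_conv_sum_set_nat o_def)

lemma arch_ge_if_rows_dominated:
  assumes A: "A \<in> mats n" and B: "B \<in> mats n"
    and "\<forall>x \<in> set (rows A). dominated n (rows B) x"
  shows "arch_ge n A B"
proof -
  obtain k l where "A \<in> carrier_mat k n" "B \<in> carrier_mat l n"
    using A B by (auto simp: mats_def)
  then show ?thesis
    using sum_sq_le_if_dominated[OF assms(3)]
    by (simp add: arch_ge_iff[OF A B] norm_sq_eq_sum_sq_rows)
qed

section \<open>Gaussian elimination with partial pivoting\<close>

definition lead :: "'a :: zero vec \<Rightarrow> nat" where
  "lead x = (LEAST j. j < dim_vec x \<and> x $ j \<noteq> 0)"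

text \<open>The induction runs from column \<open>n\<close> down to column \<open>0\<close>, for rows whose first
  \<open>j\<close> entries vanish. Row \<open>p\<close> itself stays in the list to be cleared, where it becomes
  a harmless zero row, so that all rows can be treated alike.\<close>

lemma echelon_rows_exist:
  fixes xs :: "'a :: linordered_field vec list"
  assumes "j \<le> n"
    and "\<forall>x \<in> set xs. x \<in> carrier_vec n \<and> (\<forall>i < j. x $ i = 0)"
  shows "\<exists>es. length es \<le> n - j \<and> sorted_wrt (<) (map lead es) \<and>
    (\<forall>e \<in> set es. e \<in> carrier_vec n \<and> e \<noteq> 0\<^sub>v n \<and> j \<le> lead e) \<and>
    (\<forall>x \<in> set xs. dominated n es x) \<and> (\<forall>e \<in> set es. dominated n xs e)"
  using assms
proof (induction j arbitrary: xs rule: inc_induct)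
  case base
  have "dominated n [] x" if "x \<in> set xs" for x
  proof -
    have "x = 0\<^sub>v n"
      using that base by (intro eq_vecI) auto
    then show ?thesis by (simp add: dominated_zero)
  qed
  then show ?case
    by (intro exI[of _ "[]"]) simp
next
  case (step j)
  show ?case
  proof (cases "\<forall>x \<in> set xs. x $ j = 0")
    case True
    then have "\<forall>x \<in> set xs. x \<in> carrier_vec n \<and> (\<forall>i < Suc j. x $ i = 0)"
      using step.prems by (auto simp: less_Suc_eq)
    from step.IH[OF this] show ?thesis
      by (elim exE) (rule exI, force)
  next
    case False
    define M where "M = Max ((\<lambda>x. \<bar>x $ j\<bar>) ` set xs)"
    have "set xs \<noteq> {}" using False by auto
    then have "M \<in> (\<lambda>x. \<bar>x $ j\<bar>) ` set xs"
      unfolding M_def by (intro Max_in) auto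
    then obtain p where p: "p \<in> set xs" and "M = \<bar>p $ j\<bar>" by auto
    then have max: "\<bar>x $ j\<bar> \<le> \<bar>p $ j\<bar>" if "x \<in> set xs" for x
      using that unfolding M_def by (metis Max_ge finite_imageI finite_set imageI)
    have pj: "p $ j \<noteq> 0" using False max by force
    have pn: "p \<in> carrier_vec n" and p0: "\<forall>i < j. p $ i = 0"
      using p step.prems by auto
    define c where "c = (\<lambda>x. x $ j / p $ j)"
    define clear where "clear = (\<lambda>x. x + (- c x) \<cdot>\<^sub>v p)"
    have c: "\<bar>c x\<bar> \<le> 1" if "x \<in> set xs" for x
      using max[OF that] pj by (simp add: c_def abs_divide divide_le_eq)
    have clear_carrier: "clear x \<in> carrier_vec n" if "x \<in> set xs" for x
      using that step.prems pn by (auto simp: clear_def)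
    have "clear x $ i = 0" if "x \<in> set xs" "i < Suc j" for x i
      using that step.prems step.hyps pn p0 pj
      by (cases "i = j") (auto simp: clear_def c_def)
    with clear_carrier
    have "\<forall>x \<in> set (map clear xs). x \<in> carrier_vec n \<and> (\<forall>i < Suc j. x $ i = 0)"
      by auto
    from step.IH[OF this] obtain es where len: "length es \<le> n - Suc j"
      and sorted: "sorted_wrt (<) (map lead es)"
      and es: "\<forall>e \<in> set es. e \<in> carrier_vec n \<and> e \<noteq> 0\<^sub>v n \<and> Suc j \<le> lead e"
      and dom1: "\<forall>x \<in> set (map clear xs). dominated n es x"
      and dom2: "\<forall>e \<in> set es. dominated n (map clear xs) e"
      by blast
    have lead_p: "lead p = j"
      unfolding lead_def
      using step.hyps pn p0 pj by (intro Least_equality) (auto simp: not_less[symmetric])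
    have "dominated n (p # es) x" if x: "x \<in> set xs" for x
    proof -
      have "x = clear x + c x \<cdot>\<^sub>v p"
        using x step.prems pn by (intro eq_vecI) (auto simp: clear_def)
      moreover have "dominated n (p # es) (clear x + c x \<cdot>\<^sub>v p)"
        using dom1 x clear_carrier pn c
        by (intro dominated_add_multiple) (auto intro: dominated_member dominated_mono[of n es])
      ultimately show ?thesis by simp
    qed
    moreover have "dominated n xs (clear x)" if "x \<in> set xs" for x
      unfolding clear_def using that p pn step.prems c
      by (intro dominated_add_multiple) (auto intro: dominated_member)
    then have "\<forall>e \<in> set es. dominated n xs e"
      using dom2 dominated_trans[of n "map clear xs" _ xs] by auto
    ultimately show ?thesis
      using len sorted es lead_p p pn p0 pj step.hyps
      by (intro exI[of _ "p # es"]) (auto intro: dominated_member)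
  qed
qed

section \<open>The square echelon form\<close>

lemma zero_row_iff:
  assumes "A \<in> carrier_mat m n" and "i < m"
  shows "zero_row A i \<longleftrightarrow> row A i = 0\<^sub>v n"
  using assms by (auto simp: zero_row_def vec_eq_iff)

lemma lead_col_eq_lead_row:
  assumes "i < dim_row A"
  shows "lead_col A i = lead (row A i)"
proof -
  have "(j < dim_col A \<and> A $$ (i, j) \<noteq> 0) \<longleftrightarrow> (j < dim_vec (row A i) \<and> row A i $ j \<noteq> 0)" for j
    using assms by auto
  then show ?thesis by (simp add: lead_col_def lead_def)
qed

lemma echelon_mat_of_padded_rows:
  assumes es: "\<forall>e \<in> set es. e \<in> carrier_vec n \<and> e \<noteq> 0\<^sub>v n"
    and sorted: "sorted_wrt (<) (map lead es)"
  shows "echelon (mat_of_rows n (es @ replicate k (0\<^sub>v n)))" (is "echelon ?A")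
proof -
  let ?m = "length es + k"
  have A: "?A \<in> carrier_mat ?m n" by (simp add: mat_of_rows_def)
  have row: "row ?A i = (if i < length es then es ! i else 0\<^sub>v n)" if "i < ?m" for i
    using that es by (subst mat_of_rows_row) (auto simp: nth_append)
  have zero: "zero_row ?A i \<longleftrightarrow> length es \<le> i" if "i < ?m" for i
    using es that row[OF that] by (auto simp: zero_row_iff[OF A that])
  have dim: "dim_row ?A = ?m" using A by blast
  show ?thesis
    unfolding echelon_def dim
  proof (intro conjI allI impI; elim conjE)
    fix i l assume "i < l" "l < ?m" "zero_row ?A i"
    then show "zero_row ?A l" by (simp add: zero)
  next
    fix i assume i: "Suc i < ?m" and "\<not> zero_row ?A (Suc i)"
    then have Suc_i: "Suc i < length es" by (simp add: zero)
    then have "lead (es ! i) < lead (es ! Suc i)"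
      using sorted_wrt_nth_less[OF sorted, of i "Suc i"] by simp
    then show "lead_col ?A i < lead_col ?A (Suc i)"
      using i Suc_i by (simp add: lead_col_eq_lead_row dim row)
  qed
qed

theorem corollary3p2:
  fixes n :: nat
  assumes "n \<ge> 1"
  shows "\<forall>C \<in> (arch_classes n :: 'a :: linordered_field mat set set).
           \<exists>A \<in> C. A \<in> carrier_mat n n \<and> echelon A"
proof
  fix C :: "'a mat set" assume "C \<in> arch_classes n"
  then obtain B where B: "B \<in> mats n" and C: "C = arch_rel n `` {B}"
    unfolding arch_classes_def by (auto elim: quotientE)
  have "\<forall>x \<in> set (rows B). x \<in> carrier_vec n \<and> (\<forall>i < 0. x $ i = 0)"
    using B by (auto simp: mats_def rows_def)
  from echelon_rows_exist[OF le0 this] obtain es where len: "length es \<le> n"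
    and sorted: "sorted_wrt (<) (map lead es)"
    and es: "\<forall>e \<in> set es. e \<in> carrier_vec n \<and> e \<noteq> 0\<^sub>v n"
    and dom: "\<forall>x \<in> set (rows B). dominated n es x" "\<forall>e \<in> set es. dominated n (rows B) e"
    by auto
  define ys where "ys = es @ replicate (n - length es) (0\<^sub>v n)"
  define A where "A = mat_of_rows n ys"
  have "length ys = n" using len by (simp add: ys_def)
  then have A: "A \<in> carrier_mat n n" by (simp add: A_def mat_of_rows_def)
  have rows_A: "rows A = ys"
    unfolding A_def using es by (intro rows_mat_of_rows) (auto simp: ys_def)
  have "A \<in> mats n" using A assms by (auto simp: mats_def)
  moreover have "\<forall>x \<in> set (rows A). dominated n (rows B) x"
    using dom(2) by (auto simp: rows_A ys_def dominated_zero)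
  moreover have "\<forall>x \<in> set (rows B). dominated n (rows A) x"
    using dom(1) by (auto simp: rows_A ys_def intro: dominated_mono)
  ultimately have "A \<in> C"
    using B by (auto simp: C arch_rel_def intro: arch_ge_if_rows_dominated)
  moreover have "echelon A"
    unfolding A_def ys_def using es sorted by (rule echelon_mat_of_padded_rows)
  ultimately show "\<exists>A \<in> C. A \<in> carrier_mat n n \<and> echelon A"
    using A by blast
qed

end
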